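(* (i) The following series identities hold: $$\sum_{n=0}^\infty\frac n{32^n}\sum_{k=0}^n\binom{2k}k^2\binom{2n-2k}{n-k}^2=\frac{2}{\pi},$$ $$\sum_{n=0}^\infty\frac n{54^n}\sum_{k=0}^n\binom{2k}k\binom{3k}k\binom{2(n-k)}{n-k}\binom{3(n-k)}{n-k}=\frac{\sqrt3}{\pi},$$ $$\sum_{n=0}^\infty\frac n{128^n}\sum_{k=0}^n\binom{4k}{2k}\binom{2k}k\binom{4(n-k)}{2(n-k)}\binom{2(n-k)}{n-k}=\frac{\sqrt2}{\pi},$$ $$\sum_{n=0}^\infty\frac n{864^n}\sum_{k=0}^n\binom{6k}{3k}\binom{3k}k\binom{6(n-k)}{3(n-k)}\binom{3(n-k)}{n-k}=\frac{1}{\pi}.$$ (ii) Let $p$ be an odd prime. Then $$\sum_{n=0}^{p-1}\frac n{32^n}\sum_{k=0}^n\binom{2k}k^2\binom{2(n-k)}{n-k}^2\equiv0\pmod{p^3},$$ $$\sum_{n=0}^{p-1}\frac n{128^n}\sum_{k=0}^n\binom{4k}{2k}\binom{2k}k\binom{4(n-k)}{2(n-k)}\binom{2(n-k)}{n-k}\equiv0\pmod{p^2},$$ and, if moreover $p\neq 3$, $$\sum_{n=0}^{p-1}\frac n{54^n}\sum_{k=0}^n\binom{2k}{k}\binom{3k}k\binom{2(n-k)}{n-k}\binom{3(n-k)}{n-k}\equiv0\pmod{p^2},$$ $$\sum_{n=0}^{p-1}\frac n{864^n}\sum_{k=0}^n\binom{6k}{3k}\binom{3k}k\binom{6(n-k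)}{3(n-k)}\binom{3(n-k)}{n-k}\equiv0\pmod{p^2}.$$
   Context: Congruences between rational numbers modulo a power of $p$ are understood in the ring of rationals whose denominators are prime to $p$ (all denominators here are powers of $2$ and $3$). *)

theory Defs
  imports Complex_Main "HOL-Computational_Algebra.Primes"
begin

(* The ring of rationals whose denominators are prime to p; quotient_of returns
   numerator and denominator in lowest terms, with positive denominator. *)
definition p_integers :: "nat \<Rightarrow> rat set" where
  "p_integers p = {x. coprime (snd (quotient_of x)) (int p)}"

(* x and y are congruent modulo p^e in that ring. Both sides must lie in the ring and the
   quotient z must lie there too; divisibility in the field of rationals would be vacuous. *)
definition rat_cong :: "nat \<Rightarrow> nat \<Rightarrow> rat \<Rightarrow> rat \<Rightarrow> bool" where
  "rat_cong p e x y \<longleftrightarrow>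
     x \<in> p_integers p \<and> y \<in> p_integers p \<and>
     (\<exists>z\<in>p_integers p. x - y = of_nat p ^ e * z)"

end

theory Submission
  imports Defs "HOL-Analysis.Gamma_Function" "HOL-Analysis.FPS_Convergence"
begin

text \<open>
  Each inner sum is a convolution \<open>\<Sum>k\<le>n. A k * A (n - k)\<close> with \<open>A k = m ^ k * a k\<close>, where \<open>a k\<close> are
  the coefficients of the hypergeometric series
  \<open>F z = 2F1(x, 1 - x; 1; z)\<close> with \<open>x = 1/2, 1/3, 1/4, 1/6\<close> and \<open>m = 16, 27, 64, 432\<close>. The series of
  part (i) is therefore \<open>z * (F\<^sup>2)'\<close> at \<open>z = 1/2\<close>, i.e. \<open>F (1/2) * F' (1/2)\<close>. As \<open>F z\<close> and \<open>F (1 - z)\<close>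
  solve the same self-adjoint equation, \<open>z (1 - z) (F (1 - z) F' z + F z F' (1 - z))\<close> is constant; its value
  is half the sum at \<open>z = 1/2\<close>, and it is found to be \<open>sin (pi x) / pi\<close> by letting \<open>z\<close> tend to 0 and using
  the reflection formula of the Gamma function.

  For part (ii), Clausen's formula \<open>F z ^ 2 = (\<Sum>k. (2 k choose k) a k (z (1 - z)) ^ k)\<close> turns the truncated
  sum into a sum over \<open>k < p\<close>. The terms with \<open>2 k < p\<close> contain the full derivative of \<open>(z (1 - z)) ^ k\<close>
  at its critical point \<open>1/2\<close> and vanish; in the others \<open>(2 k choose k) * A k\<close> supplies the power of \<open>p\<close>.
\<close>

section \<open>Clausen's formula\<close>

text \<open>
  With \<open>P = X - X\<^sup>2\<close>, the symmetric square of the hypergeometric equation \<open>(P F')' = c F\<close>.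
\<close>

definition clausen_op :: "'a::comm_ring_1 \<Rightarrow> 'a fps \<Rightarrow> 'a fps" where
  "clausen_op c u =
     (let P = fps_X - fps_X\<^sup>2 in
      fps_deriv (P * fps_deriv (P * fps_deriv u)) - 4 * fps_const c * P * fps_deriv u
        - 2 * fps_const c * fps_deriv P * u)"

lemma fps_nth_X_minus_X2_mult:
  "fps_nth ((fps_X - fps_X\<^sup>2) * f) n =
     (if n = 0 then 0 else fps_nth f (n - 1)) - (if n < 2 then 0 else fps_nth f (n - 2))"
  for f :: "'a::comm_ring_1 fps"
  by (simp add: left_diff_distrib fps_X_power_mult_nth)

lemma clausen_op_diff: "clausen_op c (u - v) = clausen_op c u - clausen_op c v"
  by (simp add: clausen_op_def Let_def algebra_simps)

text \<open>Near 0 the operator acts like \<open>(X (X u')')'\<close>: its coefficient at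
  \<open>n\<close> is \<open>(n + 1)^3\<close> times coefficient \<open>n + 1\<close> of
  \<open>u\<close>, plus a combination of earlier coefficients. In characteristic 0 a power series
  solution is thus determined by its constant term.\<close>

lemma clausen_op_eq_0D:
  fixes u :: "'a::field_char_0 fps"
  assumes "clausen_op c u = 0" and "fps_nth u 0 = 0"
  shows "u = 0"
proof -
  have step: "fps_nth u (Suc n) = 0" if IH: "\<And>m. m \<le> n \<Longrightarrow> fps_nth u m = 0" for n
  proof -
    have low: "fps_nth u m = 0" if "m < Suc n" for m using IH[of m] that by simp
    have P': "fps_deriv (fps_X - fps_X\<^sup>2 :: 'a fps) = 1 - fps_const 2 * fps_X"
      by (simp add: fps_deriv_power numeral_fps_const)
    have "clausen_op c u = fps_deriv ((fps_X - fps_X\<^sup>2) * fps_deriv ((fps_X - fps_X\<^sup>2) * fps_deriv u))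
      - fps_const (4 * c) * ((fps_X - fps_X\<^sup>2) * fps_deriv u)
      - fps_const (2 * c) * (u - fps_const 2 * (fps_X * u))"
      unfolding clausen_op_def Let_def P'
      by (simp add: numeral_fps_const left_diff_distrib right_diff_distrib mult.assoc
            del: fps_deriv_mult flip: fps_const_mult)
    then have "fps_nth (clausen_op c u) n = of_nat (Suc n) ^ 3 * fps_nth u (Suc n)"
      by (cases n; cases "n - 1"; cases "n - 2")
         (simp_all add: fps_nth_X_minus_X2_mult low power3_eq_cube del: fps_deriv_mult)
    then show ?thesis using assms by (simp del: of_nat_Suc)
  qed
  have "fps_nth u n = 0" for n
  proof (induction n rule: less_induct)
    case (less n)
    then show ?case using assms(2) step by (cases n) auto
  qed
  then show ?thesis by (simp add: fps_eq_iff)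
qed

text \<open>With \<open>G = P F'\<close> the equation reads \<open>G' = c F\<close>. Then
  \<open>P (F^2)' = 2 F G\<close> and \<open>P (2 F G)' = 2 G^2 + 2 c P F^2\<close>; one more
  derivative, rewritten with \<open>2 F G = P (F^2)'\<close>, yields exactly the terms subtracted in
  \<open>clausen_op\<close>.\<close>

lemma clausen_op_square:
  fixes F :: "'a::field_char_0 fps"
  assumes "fps_deriv ((fps_X - fps_X\<^sup>2) * fps_deriv F) = fps_const c * F"
  shows "clausen_op c (F\<^sup>2) = 0"
proof -
  define P G where "P = (fps_X - fps_X\<^sup>2 :: 'a fps)" and "G = P * fps_deriv F"
  have G': "fps_deriv G = fps_const c * F" using assms by (simp add: P_def G_def)
  have "P * fps_deriv (F\<^sup>2) = 2 * F * G"
    by (simp add: G_def fps_deriv_power algebra_simps power2_eq_square)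
  then have "P * fps_deriv (P * fps_deriv (F\<^sup>2)) = P * (fps_deriv (2 * F * G))" by simp
  also have "fps_deriv (2 * F * G) = 2 * fps_deriv F * G + 2 * F * (fps_const c * F)"
    by (simp add: G' algebra_simps)
  also have "P * \<dots> = 2 * G\<^sup>2 + 2 * fps_const c * (P * F\<^sup>2)"
    by (simp add: G_def algebra_simps power2_eq_square)
  finally have "fps_deriv (P * fps_deriv (P * fps_deriv (F\<^sup>2)))
     = fps_deriv (2 * G\<^sup>2 + 2 * fps_const c * (P * F\<^sup>2))" by simp
  also have "\<dots> = 4 * fps_const c * (F * G)
      + 2 * fps_const c * (fps_deriv P * F\<^sup>2 + P * fps_deriv (F\<^sup>2))"
    by (simp add: G' power2_eq_square algebra_simps)
  also have "4 * fps_const c * (F * G) = 2 * fps_const c * (2 * (F * G))"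
    by simp
  also have "2 * (F * G) = P * fps_deriv (F\<^sup>2)"
    by (simp add: G_def algebra_simps power2_eq_square)
  finally show ?thesis
    unfolding clausen_op_def Let_def P_def[symmetric]
    by (simp add: algebra_simps)
qed

text \<open>The hypothesis is the equation of \<open>H\<close> in its own variable \<open>y\<close>,
  and \<open>y = P\<close> is substituted. The chain rule brings out factors \<open>Q = P'\<close>;
  since \<open>Q^2 = 1 - 4 P\<close>, all but one of them become polynomials in \<open>P\<close>,
  and the cofactor of the remaining \<open>Q\<close> is the substituted equation.\<close>

lemma clausen_op_compose:
  fixes H :: "'a::field_char_0 fps"
  assumes "fps_X\<^sup>2 * fps_deriv (fps_deriv (fps_deriv H)) + 3 * fps_X * fps_deriv (fps_deriv H) + fps_deriv H
    = 4 * fps_X^3 * fps_deriv (fps_deriv (fps_deriv H)) + 18 * fps_X\<^sup>2 * fps_deriv (fps_deriv H)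
      + 4 * (3 + fps_const c) * fps_X * fps_deriv H + 2 * fps_const c * H"
  shows "clausen_op c (H oo (fps_X - fps_X\<^sup>2)) = 0"
proof -
  define P where "P = (fps_X - fps_X\<^sup>2 :: 'a fps)"
  define h0 h1 h2 h3 where "h0 = H oo P" and "h1 = fps_deriv H oo P"
    and "h2 = fps_deriv (fps_deriv H) oo P" and "h3 = fps_deriv (fps_deriv (fps_deriv H)) oo P"
  have P0: "fps_nth P 0 = 0" by (simp add: P_def)
  define Q where "Q = (1 - 2 * fps_X :: 'a fps)"
  have P': "fps_deriv P = Q" by (simp add: P_def Q_def fps_deriv_power)
  have Q': "fps_deriv Q = -2" by (simp add: Q_def)
  have Q2: "Q * Q = 1 - 4 * P" by (simp add: Q_def P_def algebra_simps power2_eq_square)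
  have h': "fps_deriv h0 = h1 * Q" "fps_deriv h1 = h2 * Q" "fps_deriv h2 = h3 * Q"
    by (simp_all add: h0_def h1_def h2_def h3_def fps_compose_deriv[OF P0] P')
  have [simp]: "numeral n oo P = numeral n" for n by (simp add: numeral_fps_const)
  have ode: "P * P * h3 + 3 * P * h2 + h1
    = 4 * (P * P * P) * h3 + 18 * (P * P) * h2 + 4 * (3 + fps_const c) * P * h1 + 2 * fps_const c * h0"
    \<comment> \<open>Composition with \<open>P\<close> is a ring homomorphism because
      \<open>P\<close> has constant term 0.\<close>
    using arg_cong[OF assms, of "\<lambda>f. f oo P"] P0
    by (simp add: fps_compose_add_distrib fps_compose_mult_distrib[OF P0] fps_compose_power[OF P0]
        h0_def h1_def h2_def h3_def power2_eq_square power3_eq_cube)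
  have "fps_deriv (P * fps_deriv (P * fps_deriv h0)) - 4 * fps_const c * P * fps_deriv h0
        - 2 * fps_const c * fps_deriv P * h0 = 
      Q * (Q * Q * P * (P * h3 + 3 * h2) + Q * Q * h1 - 6 * (P * (P * h2)) - 8 * (P * h1)
         - 4 * fps_const c * P * h1 - 2 * fps_const c * h0)"
    by (simp add: h' P' Q' algebra_simps)
  also have "\<dots> = Q * (P * P * h3 + 3 * P * h2 + h1 - (4 * (P * P * P) * h3 + 18 * (P * P) * h2 + 4 * (3 + fps_const c) * P * h1 + 2 * fps_const c * h0))"
    by (simp add: Q2 algebra_simps)
  also have "\<dots> = 0" by (simp add: ode)
  finally show ?thesis unfolding clausen_op_def Let_def P_def[symmetric] h0_def[symmetric] .
qed

text \<open>The power factors as \<open>X^k (1 - X)^k\<close>; the first factor shifts the binomial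
  expansion of the second by \<open>k\<close>.\<close>

lemma fps_nth_X_minus_X2_power:
  "fps_nth ((fps_X - fps_X\<^sup>2 :: 'a::comm_ring_1 fps) ^ k) n =
     (if k \<le> n then (-1) ^ (n - k) * of_nat (k choose (n - k)) else 0)"
proof -
  have "(fps_X - fps_X\<^sup>2 :: 'a fps) ^ k = fps_X ^ k * (1 - fps_X) ^ k"
    by (simp add: algebra_simps power2_eq_square flip: power_mult_distrib)
  also have "(1 - fps_X :: 'a fps) ^ k = (\<Sum>j\<le>k. of_nat (k choose j) * (- fps_X) ^ j)"
    using binomial_ring[of "- fps_X :: 'a fps" 1 k] by simp
  finally have *: "(fps_X - fps_X\<^sup>2 :: 'a fps) ^ k = fps_X ^ k * \<dots>" .
  have "fps_nth (\<Sum>j\<le>k. of_nat (k choose j) * (- fps_X) ^ j :: 'a fps) m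
      = (-1) ^ m * of_nat (k choose m)" for m
  proof -
    have "fps_nth (of_nat (k choose j) * (- fps_X) ^ j :: 'a fps) m
      = (if j = m then (-1) ^ m * of_nat (k choose m) else 0)" for j
    proof -
      have pow: "(- fps_X :: 'a fps) ^ j = fps_const ((-1) ^ j) * fps_X ^ j"
        by (subst power_minus) (cases "even j"; simp)
      show ?thesis unfolding pow fps_of_nat[symmetric] by (auto simp: fps_X_power_nth simp del: fps_of_nat)
    qed
    then show ?thesis by (simp add: fps_sum_nth binomial_eq_0)
  qed
  then show ?thesis by (auto simp: * fps_X_power_mult_nth)
qed

lemma central_binomial_Suc:
  "Suc k * (2 * Suc k choose Suc k) = 2 * (2 * k + 1) * (2 * k choose k)"
proof -
  have *: "real (2 * n choose n) = fact (2 * n) / fact n ^ 2" for n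
    by (simp add: binomial_fact power2_eq_square)
  have "real (Suc k * (2 * Suc k choose Suc k)) = real (2 * (2 * k + 1) * (2 * k choose k))"
    unfolding of_nat_mult * by (simp add: divide_simps power2_eq_square) (simp add: algebra_simps)
  then show ?thesis using of_nat_eq_iff by blast
qed

text \<open>Coefficient \<open>n\<close> of \<open>(P F')'\<close> is
  \<open>(n + 1)^2 a (n + 1) - n (n + 1) a n\<close>, so the differential equation is the recurrence
  read coefficientwise.\<close>

lemma hypergeometric_fps_ode:
  fixes a :: "nat \<Rightarrow> 'a::field_char_0"
  assumes rec: "\<And>k. of_nat (Suc k) ^ 2 * a (Suc k) = (of_nat k ^ 2 + of_nat k + c) * a k"
  shows "fps_deriv ((fps_X - fps_X\<^sup>2) * fps_deriv (Abs_fps a)) = fps_const c * Abs_fps a"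
proof (rule fps_ext)
  fix n
  show "fps_nth (fps_deriv ((fps_X - fps_X\<^sup>2) * fps_deriv (Abs_fps a))) n = fps_nth (fps_const c * Abs_fps a) n"
    using rec[of n]
    by (cases n)
      (simp_all add: fps_nth_X_minus_X2_mult power2_eq_square del: fps_deriv_mult, simp_all add: algebra_simps)
qed

text \<open>This is Clausen's formula \<open>F^2 = H oo P\<close> compared coefficientwise. Both
  series are annihilated by \<open>clausen_op c\<close> and have constant term 1, so they agree by
  uniqueness.\<close>

lemma clausen_convolution:
  fixes a :: "nat \<Rightarrow> 'a::field_char_0"
  assumes "a 0 = 1"
    and rec: "\<And>k. of_nat (Suc k) ^ 2 * a (Suc k) = (of_nat k ^ 2 + of_nat k + c) * a k"
  shows "(\<Sum>k=0..n. a k * a (n - k)) =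
    (\<Sum>k=0..n. of_nat (2 * k choose k) * a k * ((-1) ^ (n - k) * of_nat (k choose (n - k))))"
proof -
  define F where "F = Abs_fps a"
  define H where "H = Abs_fps (\<lambda>k. of_nat (2 * k choose k) * a k)"
  let ?P = "fps_X - fps_X\<^sup>2 :: 'a fps"
  have "fps_deriv (?P * fps_deriv F) = fps_const c * F"
    unfolding F_def by (rule hypergeometric_fps_ode[OF rec])
  then have LF: "clausen_op c (F\<^sup>2) = 0" by (rule clausen_op_square)
  have LH: "clausen_op c (H oo ?P) = 0"
  proof (rule clausen_op_compose, rule fps_ext)
    fix n
    define d where "d k = fps_nth H k" for k
    \<comment> \<open>The product of the recurrences of the central binomials and of
      \<open>a\<close>.\<close>
    have d: "of_nat (Suc k) ^ 3 * d (Suc k) = 2 * (2 * of_nat k + 1) * (of_nat k ^ 2 + of_nat k + c) * d k" for k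
    proof -
      have "of_nat (Suc k) ^ 3 * d (Suc k) =
         of_nat (Suc k * (2 * Suc k choose Suc k)) * (of_nat (Suc k) ^ 2 * a (Suc k))"
        by (simp add: d_def H_def power3_eq_cube power2_eq_square mult_ac del: mult_Suc_right mult_Suc of_nat_Suc binomial_Suc_Suc)
      also have "\<dots> = 2 * (2 * of_nat k + 1) * (of_nat k ^ 2 + of_nat k + c) * d k"
        unfolding central_binomial_Suc rec by (simp add: d_def H_def) (simp add: algebra_simps)
      finally show ?thesis .
    qed
    \<comment> \<open>The left side is \<open>(X (X H')')'\<close>, so comparing coefficients at
      \<open>n\<close> gives precisely the recurrence \<open>d\<close>.\<close>
    show "fps_nth (fps_X\<^sup>2 * fps_deriv (fps_deriv (fps_deriv H)) + 3 * fps_X * fps_deriv (fps_deriv H) + fps_deriv H) n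
      = fps_nth (4 * fps_X^3 * fps_deriv (fps_deriv (fps_deriv H)) + 18 * fps_X\<^sup>2 * fps_deriv (fps_deriv H)
      + 4 * (3 + fps_const c) * fps_X * fps_deriv H + 2 * fps_const c * H) n"
    proof -
      have 1: "fps_nth (fps_X\<^sup>2 * fps_deriv (fps_deriv (fps_deriv H)) + 3 * fps_X * fps_deriv (fps_deriv H) + fps_deriv H) n
        = of_nat (Suc n) ^ 3 * d (Suc n)"
        by (cases n; cases "n - 1")
          (simp_all add: mult.assoc numeral_fps_const fps_X_power_mult_nth d_def power3_eq_cube,
            simp_all add: algebra_simps)
      have 2: "fps_nth (4 * fps_X^3 * fps_deriv (fps_deriv (fps_deriv H)) + 18 * fps_X\<^sup>2 * fps_deriv (fps_deriv H)
      + 4 * (3 + fps_const c) * fps_X * fps_deriv H + 2 * fps_const c * H) n = 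
        2 * (2 * of_nat n + 1) * (of_nat n ^ 2 + of_nat n + c) * d n"
        by (cases n; cases "n - 1"; cases "n - 2")
          (simp_all add: mult.assoc numeral_fps_const fps_X_power_mult_nth d_def power2_eq_square power3_eq_cube,
            simp_all add: algebra_simps)
      show ?thesis unfolding 1 2 by (rule d)
    qed
  qed
  have nth0: "fps_nth (F\<^sup>2) 0 = fps_nth (H oo ?P) 0"
    by (simp add: F_def H_def assms(1) power2_eq_square)
  have "clausen_op c (F\<^sup>2 - (H oo ?P)) = 0" by (simp only: clausen_op_diff LF LH diff_self)
  moreover have "fps_nth (F\<^sup>2 - (H oo ?P)) 0 = 0" by (simp only: fps_sub_nth nth0 diff_self)
  ultimately have "F\<^sup>2 - (H oo ?P) = 0" by (rule clausen_op_eq_0D)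
  then have "F\<^sup>2 = H oo ?P" by (simp only: right_minus_eq)
  then have "(\<Sum>k=0..n. a k * a (n - k)) = fps_nth (H oo ?P) n"
    using fps_square_nth[of F n] by (simp add: F_def atLeast0AtMost)
  also have "\<dots> = (\<Sum>k=0..n. of_nat (2 * k choose k) * a k * ((-1) ^ (n - k) * of_nat (k choose (n - k))))"
    unfolding fps_compose_nth fps_nth_X_minus_X2_power H_def fps_nth_Abs_fps
    by (intro sum.cong refl) simp
  finally show ?thesis .
qed

section \<open>The series at one half\<close>

lemma fps_conv_radius_ge_1_if_convergent:
  fixes b :: "nat \<Rightarrow> real"
  assumes "convergent b"
  shows "fps_conv_radius (Abs_fps b) \<ge> 1"
  unfolding fps_conv_radius_def fps_nth_Abs_fps
proof (rule conv_radius_geI_ex')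
  fix r :: real assume r: "0 < r" "ereal r < 1"
  from convergent_imp_Bseq[OF assms] obtain K where K: "\<And>n. norm (b n) \<le> K"
    by (auto simp: Bseq_def)
  show "summable (\<lambda>n. b n * of_real r ^ n)"
  proof (rule summable_comparison_test')
    show "summable (\<lambda>n. K * r ^ n)" using r by (intro summable_mult summable_geometric) auto
    show "norm (b n * of_real r ^ n) \<le> K * r ^ n" if "n \<ge> 0" for n
      using K[of n] r by (simp add: abs_mult mult_right_mono)
  qed
qed

text \<open>Since \<open>(1 - t) * t ^ n\<close> sums to 1 over \<open>n\<close>, the expression is
  a weighted mean of the \<open>b n\<close>, and the weight of any finite set of indices tends to 0
  as \<open>t\<close> tends to 1.\<close>

lemma abel_limit_coefficients:
  fixes b :: "nat \<Rightarrow> real"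
  assumes lim: "b \<longlonglongrightarrow> L"
  shows "((\<lambda>t. (1 - t) * eval_fps (Abs_fps b) t) \<longlongrightarrow> L) (at_left 1)"
proof (rule tendstoI)
  fix e :: real assume "e > 0"
  define d where "d n = \<bar>b n - L\<bar>" for n
  obtain N where N: "\<And>n. n \<ge> N \<Longrightarrow> d n < e / 2"
    using metric_LIMSEQ_D[OF lim, of "e / 2"] \<open>e > 0\<close> by (auto simp: d_def dist_real_def)
  define C where "C = (\<Sum>n<N. d n)"
  have "((\<lambda>t. (1 - t) * C) \<longlongrightarrow> (1 - 1) * C) (at_left 1)" by (intro tendsto_intros)
  then have "eventually (\<lambda>t. (1 - t) * C < e / 2) (at_left 1)"
    using \<open>e > 0\<close> by (intro order_tendstoD(2)) auto
  moreover have "eventually (\<lambda>t::real. 0 < t \<and> t < 1) (at_left 1)"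
    using eventually_at_left_real[of 0 1] by (auto elim: eventually_mono)
  ultimately show "eventually (\<lambda>t. dist ((1 - t) * eval_fps (Abs_fps b) t) L < e) (at_left 1)"
  proof eventually_elim
    case (elim t)
    have g: "(\<lambda>n. t ^ n) sums (1 / (1 - t))" using elim by (intro geometric_sums) auto
    have conv: "ereal (norm t) < fps_conv_radius (Abs_fps b)"
      using fps_conv_radius_ge_1_if_convergent[of b] lim elim
      by (intro less_le_trans[OF _ fps_conv_radius_ge_1_if_convergent]) (auto simp: convergent_def)
    have "(\<lambda>n. b n * t ^ n - L * t ^ n) sums (eval_fps (Abs_fps b) t - L * (1 / (1 - t)))"
      using sums_eval_fps[OF conv] by (intro sums_diff sums_mult g) simp_all
    then have s1: "(\<lambda>n. (b n - L) * t ^ n) sums (eval_fps (Abs_fps b) t - L / (1 - t))"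
      by (simp add: left_diff_distrib)
    \<comment> \<open>A majorant of the error: the first \<open>N\<close> deviations, with
      \<open>t ^ n\<close> bounded by 1, plus \<open>e / 2 * t ^ n\<close> for every
      \<open>n\<close>. Multiplied by \<open>1 - t\<close>, its sum is
      \<open>(1 - t) * C + e / 2\<close>.\<close>
    have s2: "(\<lambda>n. (if n \<in> {..<N} then d n else 0) + e / 2 * t ^ n) sums (C + e / 2 * (1 / (1 - t)))"
      unfolding C_def by (intro sums_add sums_mult g sums_If_finite_set) auto
    have bound: "\<bar>(b n - L) * t ^ n\<bar> \<le> (if n \<in> {..<N} then d n else 0) + e / 2 * t ^ n" for n
    proof -
      have t: "0 \<le> t ^ n" "t ^ n \<le> 1" using elim by (auto intro: power_le_one)
      have "\<bar>(b n - L) * t ^ n\<bar> = d n * t ^ n" using t by (simp add: d_def abs_mult)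
      also have "\<dots> \<le> (if n \<in> {..<N} then d n else 0) + e / 2 * t ^ n"
      proof (cases "n < N")
        case True
        have "d n * t ^ n \<le> d n * 1" by (intro mult_left_mono t) (simp add: d_def)
        then show ?thesis using True t \<open>e > 0\<close> by (simp add: add_increasing2)
      next
        case False
        then show ?thesis using mult_right_mono[OF less_imp_le[OF N[of n]], of "t ^ n"] t by simp
      qed
      finally show ?thesis .
    qed
    have "eval_fps (Abs_fps b) t - L / (1 - t) \<le> C + e / 2 * (1 / (1 - t))"
      by (rule sums_le[OF _ s1 s2]) (meson abs_le_D1 bound)
    moreover have "- (eval_fps (Abs_fps b) t - L / (1 - t)) \<le> C + e / 2 * (1 / (1 - t))"
      by (rule sums_le[OF _ sums_minus[OF s1] s2]) (meson abs_le_D2 bound)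
    ultimately have "\<bar>eval_fps (Abs_fps b) t - L / (1 - t)\<bar> \<le> C + e / 2 * (1 / (1 - t))"
      by simp
    then have "(1 - t) * \<bar>eval_fps (Abs_fps b) t - L / (1 - t)\<bar> \<le> (1 - t) * (C + e / 2 * (1 / (1 - t)))"
      using elim by (intro mult_left_mono) auto
    also have "\<dots> = (1 - t) * C + e / 2" using elim by (simp add: field_simps)
    also have "\<dots> < e" using elim by simp
    also have "(1 - t) * \<bar>eval_fps (Abs_fps b) t - L / (1 - t)\<bar> = \<bar>(1 - t) * (eval_fps (Abs_fps b) t - L / (1 - t))\<bar>"
      using elim by (simp add: abs_mult)
    also have "(1 - t) * (eval_fps (Abs_fps b) t - L / (1 - t)) = (1 - t) * eval_fps (Abs_fps b) t - L"
      using elim by (simp add: field_simps)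
    finally show ?case by (simp add: dist_real_def)
  qed
qed

section \<open>The hypergeometric coefficients: recurrence and growth\<close>

lemma pochhammer_product_recurrence:
  fixes x :: real
  defines "a \<equiv> \<lambda>n. pochhammer x n * pochhammer (1 - x) n / fact n ^ 2"
  shows "of_nat (Suc n) ^ 2 * a (Suc n) = (of_nat n ^ 2 + of_nat n + x * (1 - x)) * a n"
  unfolding a_def by (simp add: pochhammer_Suc divide_simps) (simp add: algebra_simps power2_eq_square)

text \<open>Gauss's limit gives \<open>pochhammer x (n + 1) / (fact n * n^x)\<close> tending to the
  reciprocal of Gamma at \<open>x\<close>. Multiplying the limits for \<open>x\<close> and
  \<open>1 - x\<close> merges the powers of \<open>n\<close> into \<open>n\<close> itself, and the
  reflection formula evaluates the product.\<close>

lemma pochhammer_product_asymptotics: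
  fixes x :: real
  assumes "0 < x" "x < 1"
  defines "a \<equiv> \<lambda>n. pochhammer x n * pochhammer (1 - x) n / fact n ^ 2"
  shows "(\<lambda>n. real (Suc n) * a (Suc n)) \<longlonglongrightarrow> sin (pi * x) / pi"
proof -
  have "complex_of_real (rGamma x * rGamma (1 - x)) = complex_of_real (sin (pi * x) / pi)"
    using rGamma_reflection_complex[of "complex_of_real x"]
    by (simp add: rGamma_complex_of_real[symmetric] sin_of_real[symmetric])
  then have refl: "rGamma x * rGamma (1 - x) = sin (pi * x) / pi"
    by (rule of_real_eq_iff[THEN iffD1])
  \<comment> \<open>The product of the two series equals \<open>(n + 1)^2 * a (n + 1) / n\<close>;
    the factor \<open>n / (n + 1)\<close>, with limit 1, corrects it to
    \<open>(n + 1) * a (n + 1)\<close>.\<close>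
  have "(\<lambda>n. rGamma_series x n * rGamma_series (1 - x) n * (real n / real (Suc n)))
       \<longlonglongrightarrow> rGamma x * rGamma (1 - x) * 1"
    by (intro tendsto_mult rGamma_series_LIMSEQ LIMSEQ_n_over_Suc_n)
  moreover have "eventually (\<lambda>n. rGamma_series x n * rGamma_series (1 - x) n * (real n / real (Suc n))
     = real (Suc n) * a (Suc n)) sequentially"
    using eventually_gt_at_top[of 0]
  proof eventually_elim
    case (elim n)
    have "exp (x * ln (real n)) * exp ((1 - x) * ln (real n)) = real n"
      using elim by (simp add: mult_exp_exp algebra_simps)
    then have "rGamma_series x n * rGamma_series (1 - x) n 
       = pochhammer x (Suc n) * pochhammer (1 - x) (Suc n) / (fact n ^ 2 * real n)"
      unfolding rGamma_series_def by (simp add: power2_eq_square mult_ac)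
    then show ?case using elim by (simp add: a_def power2_eq_square field_simps del: of_nat_Suc)
  qed
  ultimately show ?thesis unfolding refl by (simp add: tendsto_cong)
qed

lemma hypergeometric_square_sums:
  fixes x :: real
  assumes x: "0 < x" "x < 1"
  defines "a \<equiv> \<lambda>n. pochhammer x n * pochhammer (1 - x) n / fact n ^ 2"
  shows "(\<lambda>n. real n * (\<Sum>k=0..n. a k * a (n - k)) / 2 ^ n) sums (2 * sin (pi * x) / pi)"
proof -
  define c where "c = x * (1 - x)"
  define F where "F = Abs_fps a"
  define G where "G = (fps_X - fps_X\<^sup>2) * fps_deriv F"
  define f where "f = eval_fps F"
  define f' where "f' = eval_fps (fps_deriv F)"
  define g where "g = eval_fps G"
  have a_Suc: "real (Suc n) ^ 2 * a (Suc n) = (real n ^ 2 + real n + c) * a n" for n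
    unfolding a_def c_def by (rule pochhammer_product_recurrence)
  have lim1: "(\<lambda>n. real (Suc n) * a (Suc n)) \<longlonglongrightarrow> sin (pi * x) / pi"
    unfolding a_def by (rule pochhammer_product_asymptotics[OF x])
  have lim0: "a \<longlonglongrightarrow> 0"
  proof -
    have "(\<lambda>n. real (Suc n) * a (Suc n) * inverse (real (Suc n))) \<longlonglongrightarrow> sin (pi * x) / pi * 0"
      by (intro tendsto_mult lim1 LIMSEQ_inverse_real_of_nat)
    then have "(\<lambda>n. a (Suc n)) \<longlonglongrightarrow> 0" by (simp add: field_simps del: of_nat_Suc)
    then show ?thesis by (rule LIMSEQ_imp_Suc)
  qed
  have F': "fps_deriv F = Abs_fps (\<lambda>n. real (Suc n) * a (Suc n))"
    by (simp add: F_def fps_eq_iff)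
  have G': "fps_deriv G = fps_const c * F"
    unfolding G_def F_def by (rule hypergeometric_fps_ode[OF a_Suc])
  have rF: "1 \<le> fps_conv_radius F"
    unfolding F_def using lim0 by (intro fps_conv_radius_ge_1_if_convergent) (auto simp: convergent_def)
  have rF': "1 \<le> fps_conv_radius (fps_deriv F)"
    using rF fps_conv_radius_deriv[of F] by simp
  have conv: "ereal (norm t) < fps_conv_radius F" "ereal (norm t) < fps_conv_radius (fps_deriv F)"
    if "\<bar>t\<bar> < 1" for t :: real
    using that by (auto intro!: less_le_trans[OF _ rF] less_le_trans[OF _ rF'])
  have rP: "fps_conv_radius (fps_X - fps_X\<^sup>2 :: real fps) = \<infinity>"
    using fps_conv_radius_diff[of "fps_X :: real fps" "fps_X\<^sup>2"] by simp
  have rG: "1 \<le> fps_conv_radius G"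
    using fps_conv_radius_mult[of "fps_X - fps_X\<^sup>2" "fps_deriv F"] rF' unfolding G_def rP by simp
  have f_deriv: "(f has_field_derivative f' t) (at t)" if "\<bar>t\<bar> < 1" for t
    unfolding f_def f'_def using conv[OF that] by (intro has_field_derivative_eval_fps)
  have g_eq: "g t = t * (1 - t) * f' t" if "\<bar>t\<bar> < 1" for t
    unfolding g_def G_def f'_def using conv[OF that]
    by (simp add: eval_fps_mult rP eval_fps_diff) (simp add: algebra_simps power2_eq_square)
  have g_deriv: "(g has_field_derivative c * f t) (at t)" if "\<bar>t\<bar> < 1" for t
  proof -
    have "(g has_field_derivative eval_fps (fps_deriv G) t) (at t)"
      unfolding g_def using that rG by (intro has_field_derivative_eval_fps less_le_trans[OF _ rG]) auto
    also have "eval_fps (fps_deriv G) t = c * f t"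
      unfolding G' f_def using conv[OF that] by (simp add: eval_fps_mult)
    finally show ?thesis .
  qed
  \<comment> \<open>\<open>W\<close> is \<open>t (1 - t)\<close> times the Wronskian of
    \<open>f (1 - t)\<close> and \<open>f t\<close>; the plus sign comes from the inner derivative
    of \<open>1 - t\<close>. In its derivative the terms with \<open>c\<close> cancel, and the other
    two cancel by \<open>g_eq\<close>.\<close>
  define W where "W t = f (1 - t) * g t + f t * g (1 - t)" for t
  have W_deriv: "(W has_field_derivative 0) (at t)" if "t \<in> {0<..<1}" for t
  proof -
    have t: "\<bar>t\<bar> < 1" "\<bar>1 - t\<bar> < 1" using that by auto
    have "(W has_field_derivative (f' (1 - t) * -1) * g t + c * f t * f (1 - t)
        + (f' t * g (1 - t) + (c * f (1 - t) * -1) * f t)) (at t)"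
      unfolding W_def
      by (intro DERIV_add DERIV_mult DERIV_chain2[where f = f] DERIV_chain2[where f = g] f_deriv g_deriv t)
         (auto intro!: derivative_eq_intros)
    then show ?thesis using t by (simp add: g_eq algebra_simps)
  qed
  have "\<exists>C. \<forall>t\<in>{0<..<1}. W t = C"
    by (rule has_field_derivative_zero_constant) (auto intro!: has_field_derivative_at_within[OF W_deriv])
  then obtain C where W_const: "\<And>t. t \<in> {0<..<1} \<Longrightarrow> W t = C" by blast
  have filt: "filterlim (\<lambda>t::real. 1 - t) (at_left 1) (at_right 0)"
    unfolding filterlim_at by (auto intro!: tendsto_eq_intros eventually_at_right_less exI elim: eventually_mono simp: eventually_at_filter)
  have "(f \<longlongrightarrow> f 0) (at_right 0)"
    using DERIV_isCont[OF f_deriv[of 0]] by (auto simp: isCont_def intro: tendsto_within_subset)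
  moreover have "(f' \<longlongrightarrow> f' 0) (at_right 0)"
  proof -
    have "isCont f' 0"
      unfolding f'_def using conv(2)[of 0] by (intro DERIV_isCont[OF has_field_derivative_eval_fps]) simp
    then show ?thesis by (auto simp: isCont_def intro: tendsto_within_subset)
  qed
  \<comment> \<open>Near 1 the coefficients \<open>a\<close> of \<open>f\<close> tend to 0, so
    \<open>f\<close> is of smaller order than \<open>1 / (1 - s)\<close>, while the coefficients of
    \<open>f'\<close> have the nonzero limit \<open>lim1\<close>, which fixes its leading
    behaviour.\<close>
  moreover have "((\<lambda>t. t * f (1 - t)) \<longlongrightarrow> 0) (at_right 0)"
    using filterlim_compose[OF abel_limit_coefficients[OF lim0] filt] by (simp add: f_def F_def)
  moreover have "((\<lambda>t. t * f' (1 - t)) \<longlongrightarrow> sin (pi * x) / pi) (at_right 0)"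
    using filterlim_compose[OF abel_limit_coefficients[OF lim1] filt] by (simp add: f'_def F')
  \<comment> \<open>\<open>W t\<close> is regrouped so that each factor has a known limit at 0: the
    first summand vanishes in the limit and the second contributes the constant.\<close>
  ultimately have "((\<lambda>t. (t * f (1 - t)) * ((1 - t) * f' t) + f t * ((1 - t) * (t * f' (1 - t))))
      \<longlongrightarrow> 0 * ((1 - 0) * f' 0) + f 0 * ((1 - 0) * (sin (pi * x) / pi))) (at_right 0)"
    by (intro tendsto_intros)
  also have "f 0 = 1" by (simp add: f_def eval_fps_at_0 F_def a_def)
  finally have "((\<lambda>t. (t * f (1 - t)) * ((1 - t) * f' t) + f t * ((1 - t) * (t * f' (1 - t))))
      \<longlongrightarrow> sin (pi * x) / pi) (at_right 0)" by simp
  moreover have "eventually (\<lambda>t. (t * f (1 - t)) * ((1 - t) * f' t) + f t * ((1 - t) * (t * f' (1 - t))) = W (1/2)) (at_right 0)"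
    using eventually_at_right_real[OF zero_less_one]
  proof eventually_elim
    case (elim t)
    then show ?case using W_const[of t] W_const[of "1/2"] by (simp add: W_def g_eq algebra_simps)
  qed
  ultimately have "((\<lambda>t::real. W (1/2)) \<longlongrightarrow> sin (pi * x) / pi) (at_right 0)"
    by (simp add: tendsto_cong)
  then have "W (1/2) = sin (pi * x) / pi"
    by (simp add: tendsto_const_iff trivial_limit_at_right_real)
  \<comment> \<open>At the midpoint both summands of \<open>W\<close> equal
    \<open>f (1/2) * f' (1/2) / 4\<close>.\<close>
  then have ff': "f (1/2) * f' (1/2) = 2 * sin (pi * x) / pi"
    by (simp add: W_def g_eq mult_ac)
  \<comment> \<open>The operator \<open>X d/dX\<close> produces the factor \<open>n\<close> of the
    series; at 1/2 the factor \<open>X\<close> cancels the 2.\<close>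
  have sq: "fps_X * fps_deriv (F\<^sup>2) = fps_X * (2 * (F * fps_deriv F))"
    by (simp add: power2_eq_square algebra_simps)
  have r1: "ereal (norm (1/2::real)) < fps_conv_radius h" if "1 \<le> fps_conv_radius h" for h :: "real fps"
    by (rule less_le_trans[OF _ that]) simp
  have rFF: "1 \<le> fps_conv_radius (F * fps_deriv F)"
    by (rule order.trans[OF _ fps_conv_radius_mult]) (simp add: rF rF')
  have r2FF: "1 \<le> fps_conv_radius (2 * (F * fps_deriv F))"
    by (rule order.trans[OF _ fps_conv_radius_mult]) (simp add: rFF)
  have rX: "1 \<le> fps_conv_radius (fps_X * (2 * (F * fps_deriv F)))"
    by (rule order.trans[OF _ fps_conv_radius_mult]) (simp add: r2FF)
  have "(\<lambda>n. fps_nth (fps_X * fps_deriv (F\<^sup>2)) n * (1/2) ^ n) sums eval_fps (fps_X * fps_deriv (F\<^sup>2)) (1/2)"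
    unfolding sq by (rule sums_eval_fps[OF r1[OF rX]])
  also have "eval_fps (fps_X * fps_deriv (F\<^sup>2)) (1/2) = f (1/2) * f' (1/2)"
    unfolding sq f_def f'_def using r1[OF rF] r1[OF rF'] r1[OF rFF] r1[OF r2FF]
    by (simp add: eval_fps_mult)
  also have "(\<lambda>n. fps_nth (fps_X * fps_deriv (F\<^sup>2)) n * (1/2) ^ n) =
      (\<lambda>n. real n * (\<Sum>k=0..n. a k * a (n - k)) / 2 ^ n)"
  proof
    fix n
    show "fps_nth (fps_X * fps_deriv (F\<^sup>2)) n * (1/2) ^ n = real n * (\<Sum>k=0..n. a k * a (n - k)) / 2 ^ n"
      by (cases n) (simp_all add: fps_square_nth atLeast0AtMost F_def power_one_over divide_simps del: fps_deriv_power of_nat_Suc)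
  qed
  finally show ?thesis using ff' by simp
qed

text \<open>Equal recurrences and initial values give \<open>A k = m ^ k * a k\<close>, so the
  convolution of \<open>A\<close> carries \<open>m ^ n\<close>, leaving only \<open>2 ^ n\<close> of
  the denominator.\<close>

lemma recurrence_square_sums:
  fixes A :: "nat \<Rightarrow> nat" and m :: nat and x :: real
  assumes x: "0 < x" "x < 1" and m: "m > 0"
    and A0: "A 0 = 1"
    and rec: "\<And>k. of_nat (Suc k) ^ 2 * of_nat (A (Suc k)) = of_nat m * (of_nat k ^ 2 + of_nat k + x * (1 - x)) * of_nat (A k)"
  shows "(\<lambda>n. real n / real (2 * m) ^ n * real (\<Sum>k=0..n. A k * A (n - k))) sums (2 * sin (pi * x) / pi)"
proof -
  define a where "a n = pochhammer x n * pochhammer (1 - x) n / fact n ^ 2" for n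
  have A: "real (A k) = real m ^ k * a k" for k
  proof (induction k)
    case (Suc k)
    have "real (Suc k) ^ 2 * a (Suc k) = (real k ^ 2 + real k + x * (1 - x)) * a k"
      unfolding a_def by (rule pochhammer_product_recurrence)
    then have "real (Suc k) ^ 2 * real (A (Suc k)) = real (Suc k) ^ 2 * (real m ^ Suc k * a (Suc k))"
      unfolding rec Suc by (simp add: mult_ac del: of_nat_Suc)
    then show ?case by (simp del: of_nat_Suc power_Suc)
  qed (simp add: a_def A0)
  have "real n / real (2 * m) ^ n * real (\<Sum>k=0..n. A k * A (n - k)) = real n * (\<Sum>k=0..n. a k * a (n - k)) / 2 ^ n" for n
  proof -
    have "real (\<Sum>k=0..n. A k * A (n - k)) = real m ^ n * (\<Sum>k=0..n. a k * a (n - k))"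
      unfolding of_nat_sum of_nat_mult sum_distrib_left A
      by (intro sum.cong refl) (simp add: power_add[symmetric])
    then show ?thesis using m by (simp add: power_mult_distrib)
  qed
  then show ?thesis using hypergeometric_square_sums[OF x] unfolding a_def by simp
qed

section \<open>The truncated sums modulo powers of a prime\<close>

text \<open>The denominator in lowest terms divides every other denominator, so membership can be
  tested on any representing fraction; this makes the closure properties immediate.\<close>

lemma p_integers_iff:
  assumes "prime p"
  shows "x \<in> p_integers p \<longleftrightarrow> (\<exists>a b. \<not> int p dvd b \<and> x = of_int a / of_int b)"
proof
  assume x: "x \<in> p_integers p"
  obtain n d where nd: "quotient_of x = (n, d)" by (cases "quotient_of x")
  have "\<not> int p dvd d"
  proof
    assume "int p dvd d"
    then have "is_unit (int p)"
      using x nd by (auto simp: p_integers_def dest: coprime_common_divisor)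
    then show False using assms by (simp add: prime_nat_iff)
  qed
  then show "\<exists>a b. \<not> int p dvd b \<and> x = of_int a / of_int b"
    using quotient_of_div[OF nd] by blast
next
  assume "\<exists>a b. \<not> int p dvd b \<and> x = of_int a / of_int b"
  then obtain a b where ab: "\<not> int p dvd b" "x = of_int a / of_int b" by blast
  obtain n d where nd: "quotient_of x = (n, d)" by (cases "quotient_of x")
  have d: "d > 0" "coprime n d" "x = of_int n / of_int d"
    using quotient_of_denom_pos[OF nd] quotient_of_coprime[OF nd] quotient_of_div[OF nd] by auto
  have b0: "b \<noteq> 0" using ab(1) by auto
  have "(of_int (n * b) :: rat) = of_int (a * d)"
    using ab(2) d b0 by (simp add: field_simps)
  then have "n * b = a * d" by (simp only: of_int_eq_iff)
  then have "d dvd n * b" by simp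
  then have "d dvd b" using d(2) by (simp add: coprime_dvd_mult_right_iff coprime_commute)
  then have "\<not> int p dvd d" using ab(1) dvd_trans by blast
  then have "coprime d (int p)"
    using assms prime_imp_coprime[of "int p" d] by (simp add: coprime_commute)
  then show "x \<in> p_integers p" by (simp add: p_integers_def nd)
qed

lemma p_integersI:
  assumes "prime p" "\<not> int p dvd b"
  shows "of_int a / of_int b \<in> p_integers p"
  using assms p_integers_iff by blast

lemma p_integers_of_int: "prime p \<Longrightarrow> of_int a \<in> p_integers p"
  using p_integersI[of p 1 a] prime_gt_1_nat[of p] by simp

lemma p_integers_of_nat: "prime p \<Longrightarrow> of_nat a \<in> p_integers p"
  using p_integers_of_int[of p "int a"] by simp

lemma p_integers_inverse_of_nat:
  assumes "prime p" "\<not> p dvd b"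
  shows "1 / of_nat b \<in> p_integers p"
  using p_integersI[of p "int b" 1] assms by simp

lemma p_integers_mult:
  assumes "prime p" "x \<in> p_integers p" "y \<in> p_integers p"
  shows "x * y \<in> p_integers p"
proof -
  obtain a b c d where "\<not> int p dvd b" "x = of_int a / of_int b" "\<not> int p dvd d" "y = of_int c / of_int d"
    using assms p_integers_iff by metis
  then show ?thesis
    using assms(1) p_integersI[of p "b * d" "a * c"] by (simp add: prime_dvd_mult_iff)
qed

lemma p_integers_add:
  assumes "prime p" "x \<in> p_integers p" "y \<in> p_integers p"
  shows "x + y \<in> p_integers p"
proof -
  obtain a b c d where *: "\<not> int p dvd b" "x = of_int a / of_int b" "\<not> int p dvd d" "y = of_int c / of_int d"
    using assms p_integers_iff by metis
  then have "b \<noteq> 0" "d \<noteq> 0" by auto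
  then have "x + y = of_int (a * d + c * b) / of_int (b * d)"
    by (simp add: * add_frac_eq)
  then show ?thesis
    using assms(1) * p_integersI[of p "b * d" "a * d + c * b"] by (simp add: prime_dvd_mult_iff)
qed

lemma p_integers_sum:
  assumes "prime p" "\<And>i. i \<in> I \<Longrightarrow> f i \<in> p_integers p"
  shows "(\<Sum>i\<in>I. f i) \<in> p_integers p"
  using assms(2)
proof (induction I rule: infinite_finite_induct)
  case (insert i I)
  then show ?case using p_integers_add[OF assms(1)] by simp
qed (use p_integers_of_nat[OF assms(1), of 0] in auto)

section \<open>Reduction of the truncated sums to divisibility of single terms\<close>

text \<open>The operator \<open>y d/dy\<close> applied to \<open>(1 + y) ^ Suc m\<close>, carried
  out through the absorption identity.\<close>

lemma sum_of_nat_mult_binomial_power: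
  fixes y :: "'a::comm_ring_1"
  shows "(\<Sum>j\<le>Suc m. of_nat j * (of_nat (Suc m choose j) * y ^ j)) = of_nat (Suc m) * y * (1 + y) ^ m"
proof -
  have "(\<Sum>j\<le>Suc m. of_nat j * (of_nat (Suc m choose j) * y ^ j))
     = (\<Sum>j\<le>m. of_nat (Suc j * (Suc m choose Suc j)) * y ^ Suc j)"
    by (subst sum.atMost_Suc_shift) (simp only: of_nat_mult of_nat_0 mult_zero_left add_0 mult.assoc)
  also have "\<dots> = of_nat (Suc m) * y * (\<Sum>j\<le>m. of_nat (m choose j) * y ^ j)"
    unfolding Suc_times_binomial by (simp add: sum_distrib_left mult_ac del: of_nat_Suc mult_Suc)
  also have "(\<Sum>j\<le>m. of_nat (m choose j) * y ^ j) = (1 + y) ^ m"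
    using binomial_ring[of y 1 m] by (simp add: add.commute)
  finally show ?thesis .
qed

text \<open>The sum is \<open>z d/dz\<close> of \<open>(z (1 - z)) ^ k\<close> at the critical point
  \<open>z = 1/2\<close>. The bound \<open>2 * k < N\<close> ensures that no coefficient of this
  polynomial of degree \<open>2 * k\<close> is cut off.\<close>

lemma critical_sum_eq_0:
  assumes "2 * k < N"
  shows "(\<Sum>n=k..<N. of_nat n * ((-1) ^ (n - k) * of_nat (k choose (n - k))) / 2 ^ n) = (0::'a::field_char_0)"
proof -
  let ?f = "\<lambda>n. of_nat n * ((-1) ^ (n - k) * of_nat (k choose (n - k))) / 2 ^ n :: 'a"
  have "(\<Sum>n=k..<N. ?f n) = (\<Sum>n=k..2*k. ?f n)"
    using assms by (intro sum.mono_neutral_right) (auto simp: binomial_eq_0)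
  also have "\<dots> = (\<Sum>j\<le>k. ?f (k + j))"
    using sum.shift_bounds_cl_nat_ivl[of ?f 0 k k]
    by (simp add: atLeast0AtMost mult_2 add.commute)
  also have "\<dots> = (\<Sum>j\<le>k. 1 / 2 ^ k * (of_nat k * (of_nat (k choose j) * (-1/2) ^ j)
     + of_nat j * (of_nat (k choose j) * (-1/2) ^ j)))"
    unfolding power_divide[of "-1"] by (intro sum.cong refl) (simp add: power_add field_simps)
  also have "\<dots> = 1 / 2 ^ k * (of_nat k * (\<Sum>j\<le>k. of_nat (k choose j) * (-1/2) ^ j)
     + (\<Sum>j\<le>k. of_nat j * (of_nat (k choose j) * (-1/2) ^ j)))"
    by (simp only: sum_distrib_left[symmetric] sum.distrib)
  also have "(\<Sum>j\<le>k. of_nat (k choose j) * (-1/2) ^ j) = (1/2 :: 'a) ^ k"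
    using binomial_ring[of "-1/2 :: 'a" 1 k] by simp
  \<comment> \<open>For \<open>k > 0\<close> the second sum is
    \<open>k * (-1/2) * (1/2) ^ (k - 1)\<close>, the negative of the first term.\<close>
  also have "of_nat k * (1/2) ^ k + (\<Sum>j\<le>k. of_nat j * (of_nat (k choose j) * (-1/2) ^ j)) = (0::'a)"
  proof (cases k)
    case (Suc m)
    show ?thesis unfolding Suc sum_of_nat_mult_binomial_power by (simp add: field_simps)
  qed simp
  finally show ?thesis by simp
qed

text \<open>Clausen's formula followed by an exchange of summation writes the truncated sum as the
  sum of \<open>D k * R k\<close> over \<open>k < p\<close>. The denominators of \<open>R k\<close>
  divide products of powers of 2 and \<open>m\<close>, hence are prime to \<open>p\<close>, and
  \<open>R k\<close> vanishes for \<open>2 * k < p\<close>; so \<open>div\<close> is asked only of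
  the upper half.\<close>

lemma clausen_convolution_cong:
  fixes A :: "nat \<Rightarrow> nat" and m :: nat and c :: rat
  assumes p: "prime p" "odd p" "\<not> p dvd m"
    and A0: "A 0 = 1"
    and rec: "\<And>k. of_nat (Suc k) ^ 2 * of_nat (A (Suc k)) = of_nat m * (of_nat k ^ 2 + of_nat k + c) * of_nat (A k)"
    and div: "\<And>k. p < 2 * k \<Longrightarrow> k < p \<Longrightarrow> p ^ e dvd (2 * k choose k) * A k"
  shows "rat_cong p e (\<Sum>n=0..p - 1. of_nat n / of_nat (2 * m) ^ n * of_nat (\<Sum>k=0..n. A k * A (n - k))) 0"
proof -
  define a :: "nat \<Rightarrow> rat" where "a k = of_nat (A k) / of_nat m ^ k" for k
  define D where "D k = (2 * k choose k) * A k" for k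
  define R :: "nat \<Rightarrow> rat" where "R k = 1 / of_nat (m ^ k) *
    (\<Sum>n=k..<p. of_nat n * ((-1) ^ (n - k) * of_nat (k choose (n - k))) / 2 ^ n)" for k
  have m0: "m \<noteq> 0" using p(3) by (metis dvd_0_right)
  have p0: "p > 0" using p(1) by (simp add: prime_gt_0_nat)
  have p2: "\<not> p dvd 2" using p(1,2) primes_dvd_imp_eq[of p 2] by auto
  have conv: "(of_nat n :: rat) / of_nat (2 * m) ^ n * of_nat (\<Sum>k=0..n. A k * A (n - k)) =
     (\<Sum>k=0..n. of_nat (D k) * (1 / of_nat (m ^ k) * (of_nat n * ((-1) ^ (n - k) * of_nat (k choose (n - k))) / 2 ^ n)))"
    (is "?l = ?r") for n
  proof -
    have "(of_nat (\<Sum>k=0..n. A k * A (n - k)) :: rat) = of_nat m ^ n * (\<Sum>k=0..n. a k * a (n - k))"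
      unfolding of_nat_sum of_nat_mult sum_distrib_left
    proof (intro sum.cong refl)
      fix k assume "k \<in> {0..n}"
      then have "(of_nat m :: rat) ^ n = of_nat m ^ k * of_nat m ^ (n - k)" by (simp flip: power_add)
      then show "(of_nat (A k) * of_nat (A (n - k)) :: rat) = of_nat m ^ n * (a k * a (n - k))"
        using m0 by (simp add: a_def)
    qed
    also have "(\<Sum>k=0..n. a k * a (n - k)) =
      (\<Sum>k=0..n. of_nat (2 * k choose k) * a k * ((-1) ^ (n - k) * of_nat (k choose (n - k))))"
    proof (rule clausen_convolution)
      show "a 0 = 1" by (simp add: a_def A0)
      show "of_nat (Suc k) ^ 2 * a (Suc k) = (of_nat k ^ 2 + of_nat k + c) * a k" for k
        using rec[of k] m0 by (simp add: a_def field_simps del: of_nat_Suc)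
    qed
    finally have "?l = of_nat n / 2 ^ n * \<dots>" using m0 by (simp add: power_mult_distrib)
    also have "\<dots> = ?r" unfolding sum_distrib_left
      by (intro sum.cong refl) (simp add: D_def a_def mult_ac)
    finally show ?thesis .
  qed
  have "(\<Sum>n=0..p - 1. of_nat n / of_nat (2 * m) ^ n * of_nat (\<Sum>k=0..n. A k * A (n - k)) :: rat) =
     (\<Sum>n=0..p - 1. \<Sum>k=0..n. of_nat (D k) * (1 / of_nat (m ^ k) * (of_nat n * ((-1) ^ (n - k) * of_nat (k choose (n - k))) / 2 ^ n)))"
    unfolding conv ..
  \<comment> \<open>Both orders run over the triangle of pairs with
    \<open>k \<le> n \<le> p - 1\<close>.\<close>
  also have "\<dots> = (\<Sum>k=0..p - 1. \<Sum>n=k..p - 1. of_nat (D k) * (1 / of_nat (m ^ k) * (of_nat n * ((-1) ^ (n - k) * of_nat (k choose (n - k))) / 2 ^ n)))"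
    unfolding sum.Sigma[OF finite_atLeastAtMost ballI[OF finite_atLeastAtMost]]
    by (rule sum.reindex_bij_witness[of _ "\<lambda>(k, n). (n, k)" "\<lambda>(n, k). (k, n)"]) auto
  also have "\<dots> = (\<Sum>k=0..p - 1. of_nat (D k) * R k)"
  proof (intro sum.cong refl)
    fix k
    have "{k..p - 1} = {k..<p}" using p0 by auto
    then show "(\<Sum>n=k..p - 1. of_nat (D k) * (1 / of_nat (m ^ k) * (of_nat n * ((-1) ^ (n - k) * of_nat (k choose (n - k))) / 2 ^ n)))
      = of_nat (D k) * R k" by (simp only: R_def sum_distrib_left)
  qed
  finally have sum_eq: "(\<Sum>n=0..p - 1. of_nat n / of_nat (2 * m) ^ n * of_nat (\<Sum>k=0..n. A k * A (n - k)) :: rat) =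
      (\<Sum>k=0..p - 1. of_nat (D k) * R k)" .
  note int = p_integers_mult[OF p(1)] p_integers_sum[OF p(1)] p_integers_of_nat[OF p(1)]
     p_integers_of_int[OF p(1)] p_integers_inverse_of_nat[OF p(1)]
  have R_int: "R k \<in> p_integers p" for k
  proof -
    have "of_nat n * ((-1) ^ (n - k) * of_nat (k choose (n - k))) / 2 ^ n \<in> p_integers p" for n
    proof -
      have "of_int (int n * ((-1) ^ (n - k) * int (k choose (n - k)))) * (1 / of_nat (2 ^ n)) \<in> p_integers p"
        using p2 p(1) by (intro int) (auto dest: prime_dvd_power)
      then show ?thesis by simp
    qed
    then show ?thesis unfolding R_def using p(1,3) by (intro int) (auto dest: prime_dvd_power)
  qed
  have "\<exists>z\<in>p_integers p. of_nat (D k) * R k = of_nat p ^ e * z" if "k \<in> {0..p - 1}" for k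
  proof (cases "2 * k < p")
    case True
    then have "R k = 0" by (simp add: R_def critical_sum_eq_0)
    then show ?thesis using int(3)[of 0] by (intro bexI[of _ 0]) auto
  next
    case False
    \<comment> \<open>Oddness of \<open>p\<close> excludes \<open>2 * k = p\<close>.\<close>
    then have "p < 2 * k" "k < p" using p(2) p0 that by (auto simp: not_less le_less)
    from div[OF this] obtain q where "D k = p ^ e * q" unfolding D_def by (elim dvdE)
    then show ?thesis using int(1)[OF int(3)[of q] R_int[of k]]
      by (intro bexI[of _ "of_nat q * R k"]) auto
  qed
  then obtain z where z: "\<And>k. k \<in> {0..p - 1} \<Longrightarrow> z k \<in> p_integers p"
     "\<And>k. k \<in> {0..p - 1} \<Longrightarrow> of_nat (D k) * R k = of_nat p ^ e * z k" by metis
  have zi: "(\<Sum>k=0..p - 1. z k) \<in> p_integers p" by (intro int z)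
  have zs: "(\<Sum>k=0..p - 1. of_nat (D k) * R k) = of_nat p ^ e * (\<Sum>k=0..p - 1. z k)"
    unfolding sum_distrib_left by (intro sum.cong refl z)
  \<comment> \<open>\<open>rat_cong\<close> also demands that the sum itself be
    \<open>p\<close>-integral, not only its quotient by \<open>p ^ e\<close>.\<close>
  have "of_nat (p ^ e) * (\<Sum>k=0..p - 1. z k) \<in> p_integers p" by (intro int zi)
  then show ?thesis
    unfolding rat_cong_def sum_eq zs using zi int(3)[of 0] by auto
qed

section \<open>Primes dividing the binomial coefficients with
  \<open>k < p \<le> 2 * k\<close>\<close>

lemma prime_dvd_central_binomial:
  fixes p k :: nat
  assumes "prime p" "k < p" "p \<le> 2 * k"
  shows "p dvd (2 * k choose k)"
proof -
  have "p dvd fact (2 * k)" using assms by (simp add: prime_dvd_fact_iff)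
  also have "fact (2 * k) = fact k * fact k * (2 * k choose k)"
    using binomial_fact_lemma[of k "2 * k"] by (simp add: mult_2)
  finally show ?thesis using assms by (simp add: prime_dvd_mult_iff prime_dvd_fact_iff)
qed

text \<open>Multiples of \<open>p\<close> are counted in the factorials. If
  \<open>2 p \<le> 3 k\<close>, then \<open>2 p\<close> lies in \<open>(2 k, 3 k]\<close> and
  \<open>p\<close> divides \<open>3 k choose k\<close>. Otherwise \<open>2 p\<close> and
  \<open>3 p\<close> both lie in \<open>(3 k, 6 k]\<close>, whereas \<open>p\<close> is the only
  multiple of \<open>p\<close> up to \<open>3 k\<close>, so a factor \<open>p\<close> survives in
  \<open>6 k choose 3 k\<close>.\<close>

lemma prime_dvd_sextic_binomial:
  fixes p k :: nat
  assumes p: "prime p" and k: "k < p" "p < 2 * k"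
  shows "p dvd (6 * k choose (3 * k)) * (3 * k choose k)"
proof (cases "2 * p \<le> 3 * k")
  case True
  have "fact (2 * k) * (fact k * (3 * k choose k)) = (fact (3 * k) :: nat)"
    using binomial_fact_lemma[of k "3 * k"] by (simp add: mult_ac)
  also have "\<dots> = fact (2 * k) * \<Prod>{Suc (2 * k)..3 * k}"
    using fact_eq_fact_times[of "2 * k" "3 * k"] by simp
  finally have "fact k * (3 * k choose k) = \<Prod>{Suc (2 * k)..3 * k}" by simp
  moreover have "2 * p dvd \<Prod>{Suc (2 * k)..3 * k}"
    using True k by (intro dvd_prodI[where f = "\<lambda>i. i", simplified]) auto
  ultimately have "p dvd fact k * (3 * k choose k)" using dvd_mult_right by metis
  then show ?thesis using p k by (simp add: prime_dvd_mult_iff prime_dvd_fact_iff)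
next
  case False
  have "fact (3 * k) * (fact (3 * k) * (6 * k choose (3 * k))) = (fact (6 * k) :: nat)"
    using binomial_fact_lemma[of "3 * k" "6 * k"] by (simp add: mult_ac)
  also have "\<dots> = fact (3 * k) * \<Prod>{Suc (3 * k)..6 * k}"
    using fact_eq_fact_times[of "3 * k" "6 * k"] by simp
  finally have *: "fact (3 * k) * (6 * k choose (3 * k)) = \<Prod>{Suc (3 * k)..6 * k}" by simp
  have "\<Prod>{2 * p, 3 * p} dvd \<Prod>{Suc (3 * k)..6 * k}"
    using False k by (intro prod_dvd_prod_subset) auto
  then have "p * (6 * p) dvd fact (3 * k) * (6 * k choose (3 * k))"
    using k unfolding * by (simp add: algebra_simps)
  \<comment> \<open>The single factor \<open>p\<close> of \<open>fact (3 * k)\<close> is isolated so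
    that it can be cancelled against one of the two on the left.\<close>
  also have "fact (3 * k) = (fact p :: nat) * \<Prod>{Suc p..3 * k}"
    using fact_eq_fact_times[of p "3 * k"] k by simp
  also have "(fact p :: nat) = p * fact (p - 1)"
    using k by (simp add: fact_reduce)
  finally have "p * (6 * p) dvd p * (fact (p - 1) * \<Prod>{Suc p..3 * k} * (6 * k choose (3 * k)))"
    by (simp add: mult_ac)
  then have "6 * p dvd fact (p - 1) * \<Prod>{Suc p..3 * k} * (6 * k choose (3 * k))"
    using k by (simp only: nat_mult_dvd_cancel_disj) auto
  then have "p dvd fact (p - 1) * \<Prod>{Suc p..3 * k} * (6 * k choose (3 * k))"
    using dvd_mult_right by blast
  moreover have "\<not> p dvd fact (p - 1)" using p k by (simp add: prime_dvd_fact_iff)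
  moreover have "\<not> p dvd \<Prod>{Suc p..3 * k}"
  proof
    assume "p dvd \<Prod>{Suc p..3 * k}"
    then obtain i where i: "i \<in> {Suc p..3 * k}" "p dvd i"
      using p by (auto simp: prime_dvd_prod_iff)
    then obtain q where q: "i = p * q" by blast
    \<comment> \<open>A multiple of \<open>p\<close> is at most \<open>p\<close> or at least
      \<open>2 * p\<close>, and \<open>3 * k < 2 * p\<close> in this case.\<close>
    consider "q \<le> 1" | "q \<ge> 2" by linarith
    then show False
    proof cases
      case 1
      then show False using mult_le_mono2[OF 1, of p] i(1) q by (simp only: atLeastAtMost_iff) linarith
    next
      case 2
      then show False using mult_le_mono2[OF 2, of p] i(1) q False by (simp only: atLeastAtMost_iff) linarith
    qed
  qed
  ultimately show ?thesis using p by (simp add: prime_dvd_mult_iff)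
qed

section \<open>Recurrences of the four binomial sequences\<close>

text \<open>The constant is \<open>x * (1 - x)\<close> for \<open>x = 1/2\<close>, and
  \<open>16 * (k^2 + k + 1/4) = 4 * (2 * k + 1)^2\<close> is an integer. The identity is checked on
  factorials over the reals and then passes through the naturals to any field of characteristic 0,
  as part (i) uses it over the reals and part (ii) over the rationals. The other three sequences
  follow the same pattern with \<open>x = 1/3, 1/4, 1/6\<close>.\<close>

lemma binomial_16_recurrence:
  fixes A :: "nat \<Rightarrow> nat"
  defines "A \<equiv> \<lambda>k. (2 * k choose k) ^ 2"
  shows "of_nat (Suc k) ^ 2 * of_nat (A (Suc k))
    = (of_nat 16 * (of_nat k ^ 2 + of_nat k + 1 / 4) * of_nat (A k) :: 'a::field_char_0)"
proof -
  have A: "real (A n) = (fact (2 * n) / fact n ^ 2) ^ 2" for n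
    by (simp add: A_def binomial_fact power2_eq_square power3_eq_cube)
  have "2 * Suc k = Suc (Suc (2 * k))" by simp
  then have fact2: "fact (2 * Suc k) = (2 * real k + 2) * (2 * real k + 1) * (fact (2 * k) :: real)"
    by (simp only: fact_Suc) (simp add: algebra_simps)
  have "real (Suc k ^ 2 * A (Suc k)) = real ((4 * (2 * k + 1) ^ 2) * A k)"
    unfolding of_nat_mult A fact_Suc fact2
    by (simp add: divide_simps power2_eq_square power3_eq_cube) (simp add: algebra_simps)
  then have "of_nat (Suc k ^ 2 * A (Suc k)) = (of_nat ((4 * (2 * k + 1) ^ 2) * A k) :: 'a)"
    by (simp only: of_nat_eq_iff)
  then show ?thesis by (simp add: algebra_simps power2_eq_square)
qed

lemma binomial_27_recurrence:
  fixes A :: "nat \<Rightarrow> nat"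
  defines "A \<equiv> \<lambda>k. (2 * k choose k) * (3 * k choose k)"
  shows "of_nat (Suc k) ^ 2 * of_nat (A (Suc k))
    = (of_nat 27 * (of_nat k ^ 2 + of_nat k + 2 / 9) * of_nat (A k) :: 'a::field_char_0)"
proof -
  have A: "real (A n) = fact (3 * n) / fact n ^ 3" for n
    by (simp add: A_def binomial_fact power2_eq_square power3_eq_cube)
  have "3 * Suc k = Suc (Suc (Suc (3 * k)))" by simp
  then have fact3: "fact (3 * Suc k) = (3 * real k + 3) * (3 * real k + 2) * (3 * real k + 1) * (fact (3 * k) :: real)"
    by (simp only: fact_Suc) (simp add: algebra_simps)
  have "real (Suc k ^ 2 * A (Suc k)) = real ((3 * (3 * k + 1) * (3 * k + 2)) * A k)"
    unfolding of_nat_mult A fact_Suc fact3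
    by (simp add: divide_simps power2_eq_square power3_eq_cube) (simp add: algebra_simps)
  then have "of_nat (Suc k ^ 2 * A (Suc k)) = (of_nat ((3 * (3 * k + 1) * (3 * k + 2)) * A k) :: 'a)"
    by (simp only: of_nat_eq_iff)
  then show ?thesis by (simp add: algebra_simps power2_eq_square)
qed

lemma binomial_64_recurrence:
  fixes A :: "nat \<Rightarrow> nat"
  defines "A \<equiv> \<lambda>k. (4 * k choose (2 * k)) * (2 * k choose k)"
  shows "of_nat (Suc k) ^ 2 * of_nat (A (Suc k))
    = (of_nat 64 * (of_nat k ^ 2 + of_nat k + 3 / 16) * of_nat (A k) :: 'a::field_char_0)"
proof -
  have A: "real (A n) = fact (4 * n) / (fact (2 * n) * fact n ^ 2)" for n
    by (simp add: A_def binomial_fact power2_eq_square power3_eq_cube)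
  have "2 * Suc k = Suc (Suc (2 * k))" by simp
  then have fact2: "fact (2 * Suc k) = (2 * real k + 2) * (2 * real k + 1) * (fact (2 * k) :: real)"
    by (simp only: fact_Suc) (simp add: algebra_simps)
  have "4 * Suc k = Suc (Suc (Suc (Suc (4 * k))))" by simp
  then have fact4: "fact (4 * Suc k) = (4 * real k + 4) * (4 * real k + 3) * (4 * real k + 2) * (4 * real k + 1) * (fact (4 * k) :: real)"
    by (simp only: fact_Suc) (simp add: algebra_simps)
  have "real (Suc k ^ 2 * A (Suc k)) = real ((4 * (4 * k + 1) * (4 * k + 3)) * A k)"
    unfolding of_nat_mult A fact_Suc fact2 fact4
    by (simp add: divide_simps power2_eq_square power3_eq_cube) (simp add: algebra_simps)
  then have "of_nat (Suc k ^ 2 * A (Suc k)) = (of_nat ((4 * (4 * k + 1) * (4 * k + 3)) * A k) :: 'a)"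
    by (simp only: of_nat_eq_iff)
  then show ?thesis by (simp add: algebra_simps power2_eq_square)
qed

lemma binomial_432_recurrence:
  fixes A :: "nat \<Rightarrow> nat"
  defines "A \<equiv> \<lambda>k. (6 * k choose (3 * k)) * (3 * k choose k)"
  shows "of_nat (Suc k) ^ 2 * of_nat (A (Suc k))
    = (of_nat 432 * (of_nat k ^ 2 + of_nat k + 5 / 36) * of_nat (A k) :: 'a::field_char_0)"
proof -
  have A: "real (A n) = fact (6 * n) / (fact (3 * n) * fact (2 * n) * fact n)" for n
    by (simp add: A_def binomial_fact power2_eq_square power3_eq_cube)
  have "2 * Suc k = Suc (Suc (2 * k))" by simp
  then have fact2: "fact (2 * Suc k) = (2 * real k + 2) * (2 * real k + 1) * (fact (2 * k) :: real)"
    by (simp only: fact_Suc) (simp add: algebra_simps)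
  have "3 * Suc k = Suc (Suc (Suc (3 * k)))" by simp
  then have fact3: "fact (3 * Suc k) = (3 * real k + 3) * (3 * real k + 2) * (3 * real k + 1) * (fact (3 * k) :: real)"
    by (simp only: fact_Suc) (simp add: algebra_simps)
  have "6 * Suc k = Suc (Suc (Suc (Suc (Suc (Suc (6 * k))))))" by simp
  then have fact6: "fact (6 * Suc k) = (6 * real k + 6) * (6 * real k + 5) * (6 * real k + 4) * (6 * real k + 3) * (6 * real k + 2) * (6 * real k + 1) * (fact (6 * k) :: real)"
    by (simp only: fact_Suc) (simp add: algebra_simps)
  have "real (Suc k ^ 2 * A (Suc k)) = real ((12 * (6 * k + 1) * (6 * k + 5)) * A k)"
    unfolding of_nat_mult A fact_Suc fact2 fact3 fact6
    by (simp add: divide_simps power2_eq_square power3_eq_cube) (simp add: algebra_simps)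
  then have "of_nat (Suc k ^ 2 * A (Suc k)) = (of_nat ((12 * (6 * k + 1) * (6 * k + 5)) * A k) :: 'a)"
    by (simp only: of_nat_eq_iff)
  then show ?thesis by (simp add: algebra_simps power2_eq_square)
qed

theorem theorem1p1:
  shows "(
     (\<lambda>n. real n / 32 ^ n *
         real (\<Sum>k=0..n. ((2*k) choose k)^2 * ((2*n - 2*k) choose (n - k))^2)) sums (2 / pi) \<and>
     (\<lambda>n. real n / 54 ^ n *
         real (\<Sum>k=0..n. ((2*k) choose k) * ((3*k) choose k) * ((2*(n - k)) choose (n - k)) * ((3*(n - k)) choose (n - k)))) sums (sqrt 3 / pi) \<and>
     (\<lambda>n. real n / 128 ^ n *
         real (\<Sum>k=0..n. ((4*k) choose (2*k)) * ((2*k) choose k) * ((4*(n - k)) choose (2*(n - k))) * ((2*(n - k)) choose (n - k)))) sums (sqrt 2 / pi) \<and>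
     (\<lambda>n. real n / 864 ^ n *
         real (\<Sum>k=0..n. ((6*k) choose (3*k)) * ((3*k) choose k) * ((6*(n - k)) choose (3*(n - k))) * ((3*(n - k)) choose (n - k)))) sums (1 / pi)
   ) \<and>
   (\<forall>p::nat. prime p \<and> odd p \<longrightarrow>
     rat_cong p 3
       (\<Sum>n=0..p - 1. of_nat n / 32 ^ n *
          of_nat (\<Sum>k=0..n. ((2*k) choose k)^2 * ((2*(n - k)) choose (n - k))^2)) 0 \<and>
     rat_cong p 2
       (\<Sum>n=0..p - 1. of_nat n / 128 ^ n *
          of_nat (\<Sum>k=0..n. ((4*k) choose (2*k)) * ((2*k) choose k) * ((4*(n - k)) choose (2*(n - k))) * ((2*(n - k)) choose (n - k)))) 0 \<and>
     (p \<noteq> 3 \<longrightarrow>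
       rat_cong p 2
         (\<Sum>n=0..p - 1. of_nat n / 54 ^ n *
            of_nat (\<Sum>k=0..n. ((2*k) choose k) * ((3*k) choose k) * ((2*(n - k)) choose (n - k)) * ((3*(n - k)) choose (n - k)))) 0 \<and>
       rat_cong p 2
         (\<Sum>n=0..p - 1. of_nat n / 864 ^ n *
            of_nat (\<Sum>k=0..n. ((6*k) choose (3*k)) * ((3*k) choose k) * ((6*(n - k)) choose (3*(n - k))) * ((3*(n - k)) choose (n - k)))) 0))"
proof -
  \<comment> \<open>In the four cases \<open>x = 1/2, 1/3, 1/4, 1/6\<close>, the value of
    \<open>2 * sin (pi * x)\<close> is 2, \<open>sqrt 3\<close>, \<open>sqrt 2\<close>, 1, and the
    base of the powers is \<open>2 * m\<close>.\<close>
  have series32: "(\<lambda>n. real n / 32 ^ n *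
         real (\<Sum>k=0..n. ((2*k) choose k)^2 * ((2*n - 2*k) choose (n - k))^2)) sums (2 / pi)"
    using recurrence_square_sums[of "1/2" 16 "\<lambda>k. (2 * k choose k) ^ 2"] binomial_16_recurrence[where 'a = real]
    by (simp add: mult.assoc diff_mult_distrib2 del: of_nat_Suc mult_Suc_right binomial_Suc_Suc)
  have series54: "(\<lambda>n. real n / 54 ^ n *
         real (\<Sum>k=0..n. ((2*k) choose k) * ((3*k) choose k) * ((2*(n - k)) choose (n - k)) * ((3*(n - k)) choose (n - k)))) sums (sqrt 3 / pi)"
    using recurrence_square_sums[of "1/3" 27 "\<lambda>k. (2 * k choose k) * (3 * k choose k)"] binomial_27_recurrence[where 'a = real]
    by (simp add: sin_60 mult.assoc diff_mult_distrib2 del: of_nat_Suc mult_Suc_right binomial_Suc_Suc)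
  have series128: "(\<lambda>n. real n / 128 ^ n *
         real (\<Sum>k=0..n. ((4*k) choose (2*k)) * ((2*k) choose k) * ((4*(n - k)) choose (2*(n - k))) * ((2*(n - k)) choose (n - k)))) sums (sqrt 2 / pi)"
    using recurrence_square_sums[of "1/4" 64 "\<lambda>k. (4 * k choose (2 * k)) * (2 * k choose k)"] binomial_64_recurrence[where 'a = real]
    by (simp add: sin_45 mult.assoc diff_mult_distrib2 del: of_nat_Suc mult_Suc_right binomial_Suc_Suc)
  have series864: "(\<lambda>n. real n / 864 ^ n *
         real (\<Sum>k=0..n. ((6*k) choose (3*k)) * ((3*k) choose k) * ((6*(n - k)) choose (3*(n - k))) * ((3*(n - k)) choose (n - k)))) sums (1 / pi)"
    using recurrence_square_sums[of "1/6" 432 "\<lambda>k. (6 * k choose (3 * k)) * (3 * k choose k)"] binomial_432_recurrence[where 'a = real]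
    by (simp add: sin_30 mult.assoc diff_mult_distrib2 del: of_nat_Suc mult_Suc_right binomial_Suc_Suc)
  have two: "\<not> p dvd 2" if "prime p" "odd p" for p :: nat
    using that primes_dvd_imp_eq[of p 2] by auto
  have three: "\<not> p dvd 3" if "prime p" "p \<noteq> 3" for p :: nat
    using that primes_dvd_imp_eq[of p 3] by auto
  have cong32: "rat_cong p 3 (\<Sum>n=0..p - 1. of_nat n / 32 ^ n *
          of_nat (\<Sum>k=0..n. ((2*k) choose k)^2 * ((2*(n - k)) choose (n - k))^2)) 0"
    if p: "prime p" "odd p" for p :: nat
  proof -
    note central = prime_dvd_central_binomial[OF p(1) _ less_imp_le]
    have "\<not> p dvd 2 ^ 4"
      using two[OF p] prime_dvd_power[OF p(1)] prime_dvd_multD[OF p(1)] by blast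
    then have m: "\<not> p dvd 16" by simp
    \<comment> \<open>The weight of Clausen's formula together with the squared term makes a cube of
      the central binomial, whence the exponent 3.\<close>
    have "p ^ 3 dvd (2 * k choose k) * (2 * k choose k) ^ 2" if "p < 2 * k" "k < p" for k
      using dvd_power_same[OF central[OF that(2,1)], of 3] by (simp add: power3_eq_cube power2_eq_square mult.assoc)
    from clausen_convolution_cong[OF p(1,2) m, of "\<lambda>k. (2 * k choose k) ^ 2", OF _ binomial_16_recurrence this]
    show ?thesis by (simp add: mult.assoc)
  qed
  have cong128: "rat_cong p 2 (\<Sum>n=0..p - 1. of_nat n / 128 ^ n *
          of_nat (\<Sum>k=0..n. ((4*k) choose (2*k)) * ((2*k) choose k) * ((4*(n - k)) choose (2*(n - k))) * ((2*(n - k)) choose (n - k)))) 0"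
    if p: "prime p" "odd p" for p :: nat
  proof -
    note central = prime_dvd_central_binomial[OF p(1) _ less_imp_le]
    have "\<not> p dvd 2 ^ 6"
      using two[OF p] prime_dvd_power[OF p(1)] prime_dvd_multD[OF p(1)] by blast
    then have m: "\<not> p dvd 64" by simp
    \<comment> \<open>One factor \<open>p\<close> comes from each of the two copies of the central
      binomial.\<close>
    have "p ^ 2 dvd (2 * k choose k) * ((4 * k choose (2 * k)) * (2 * k choose k))" if "p < 2 * k" "k < p" for k
      using mult_dvd_mono[OF central[OF that(2,1)] dvd_mult[OF central[OF that(2,1)]]] by (simp add: power2_eq_square)
    from clausen_convolution_cong[OF p(1,2) m, of "\<lambda>k. (4 * k choose (2 * k)) * (2 * k choose k)", OF _ binomial_64_recurrence this]
    show ?thesis by (simp add: mult.assoc)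
  qed
  have cong54: "rat_cong p 2 (\<Sum>n=0..p - 1. of_nat n / 54 ^ n *
            of_nat (\<Sum>k=0..n. ((2*k) choose k) * ((3*k) choose k) * ((2*(n - k)) choose (n - k)) * ((3*(n - k)) choose (n - k)))) 0"
    if p: "prime p" "odd p" "p \<noteq> 3" for p :: nat
  proof -
    note central = prime_dvd_central_binomial[OF p(1) _ less_imp_le]
    have "\<not> p dvd 3 ^ 3"
      using three[OF p(1,3)] prime_dvd_power[OF p(1)] prime_dvd_multD[OF p(1)] by blast
    then have m: "\<not> p dvd 27" by simp
    have "p ^ 2 dvd (2 * k choose k) * ((2 * k choose k) * (3 * k choose k))" if "p < 2 * k" "k < p" for k
      using mult_dvd_mono[OF central[OF that(2,1)] dvd_mult2[OF central[OF that(2,1)]]] by (simp add: power2_eq_square)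
    from clausen_convolution_cong[OF p(1,2) m, of "\<lambda>k. (2 * k choose k) * (3 * k choose k)", OF _ binomial_27_recurrence this]
    show ?thesis by (simp add: mult.assoc)
  qed
  have cong864: "rat_cong p 2 (\<Sum>n=0..p - 1. of_nat n / 864 ^ n *
            of_nat (\<Sum>k=0..n. ((6*k) choose (3*k)) * ((3*k) choose k) * ((6*(n - k)) choose (3*(n - k))) * ((3*(n - k)) choose (n - k)))) 0"
    if p: "prime p" "odd p" "p \<noteq> 3" for p :: nat
  proof -
    note central = prime_dvd_central_binomial[OF p(1) _ less_imp_le]
    have "\<not> p dvd 2 ^ 4 * 3 ^ 3"
      using two[OF p(1,2)] three[OF p(1,3)] prime_dvd_power[OF p(1)] prime_dvd_multD[OF p(1)] by blast
    then have m: "\<not> p dvd 432" by simp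
    \<comment> \<open>Only one central binomial occurs here; the second factor \<open>p\<close>
      comes from \<open>prime_dvd_sextic_binomial\<close>.\<close>
    have "p ^ 2 dvd (2 * k choose k) * ((6 * k choose (3 * k)) * (3 * k choose k))" if "p < 2 * k" "k < p" for k
      using mult_dvd_mono[OF central[OF that(2,1)] prime_dvd_sextic_binomial[OF p(1) that(2,1)]] by (simp add: power2_eq_square)
    from clausen_convolution_cong[OF p(1,2) m, of "\<lambda>k. (6 * k choose (3 * k)) * (3 * k choose k)", OF _ binomial_432_recurrence this]
    show ?thesis by (simp add: mult.assoc)
  qed
  show ?thesis
    using series32 series54 series128 series864 cong32 cong128 cong54 cong864 by blast
qed

end
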